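(* Let $p$ be a prime and let $a$ be a positive integer. Let $\sigma_{p^a}(n) := \tau_{p^a,n}$ for positive integers $n$, and denote $m := \min\{x \in \{1,2,3,\ldots\} : \sigma_{p^a}(x) = 2p^a\}$ (this minimum exists). Then $m = p^b$ for some integer $b \geq a$, and the sequence $\sigma_{p^a} = (\sigma_{p^a}(n))_{n=1}^\infty$ is periodic with the period $m$.
   Context: For positive integers $m,n$, the discrete torus is $T_{m\times n} := \{0,\ldots,m-1\}\times\{0,\ldots,n-1\}\subset\mathbb{Z}^2$, and $\pi_{m,n}:\mathbb{Z}^2\to T_{m\times n}$ is the map $(x,y)\mapsto (x \bmod m,\ y \bmod n)$. A line in $\mathbb{Z}^2$ is a set $\ell_{\mathbb{R}^2}\cap\mathbb{Z}^2$, where $\ell_{\mathbb{R}^2}$ is a line in $\mathbb{R}^2$ containing at least two points with integer coordinates (equivalently, a set $\{A+k(u,v): k\in\mathbb{Z}\}$ with $A\in\mathbb{Z}^2$, $u,v \in \mathbb{Z}$, $\gcd(u,v)=1$). A line on $T_{m\times n}$ is the image under $\pi_{m,n}$ of a line in $\mathbb{Z}^2$. Points of $T_{m\times n}$ are collinear if some line on $T_{m\times n}$ contains all of them. $\tau_{m,n}$ denotes the maximal number of points that can be placed on $T_{m\times n}$ so that no three (distinct) of these points are collinear. A sequence $(s(n))_{n\ge 1}$ is periodic with period $T$ (a positive integer, not necessarily the least such) if $s(n+T)=s(n)$ for all $n\ge 1$. *)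

theory Defs
  imports "HOL-Analysis.Analysis"
begin

definition torus :: "nat \<Rightarrow> nat \<Rightarrow> (int \<times> int) set" where
  "torus m n = {0..<int m} \<times> {0..<int n}"

definition torus_proj :: "nat \<Rightarrow> nat \<Rightarrow> int \<times> int \<Rightarrow> int \<times> int" where
  "torus_proj m n = (\<lambda>(x, y). (x mod int m, y mod int n))"

definition emb :: "int \<times> int \<Rightarrow> real \<times> real" where
  "emb = (\<lambda>(x, y). (of_int x, of_int y))"

(* A line of the real plane is an affine subspace of dimension 1. *)
definition lattice_line :: "(int \<times> int) set \<Rightarrow> bool" where
  "lattice_line L \<longleftrightarrow> (\<exists>l :: (real \<times> real) set. affine l \<and> aff_dim l = 1 \<and>
     (\<exists>P Q. P \<noteq> Q \<and> emb P \<in> l \<and> emb Q \<in> l) \<and> L = {P. emb P \<in> l})"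

definition torus_line :: "nat \<Rightarrow> nat \<Rightarrow> (int \<times> int) set \<Rightarrow> bool" where
  "torus_line m n K \<longleftrightarrow> (\<exists>L. lattice_line L \<and> K = torus_proj m n ` L)"

definition torus_collinear :: "nat \<Rightarrow> nat \<Rightarrow> (int \<times> int) set \<Rightarrow> bool" where
  "torus_collinear m n S \<longleftrightarrow> (\<exists>K. torus_line m n K \<and> S \<subseteq> K)"

definition no_three_collinear :: "nat \<Rightarrow> nat \<Rightarrow> (int \<times> int) set \<Rightarrow> bool" where
  "no_three_collinear m n S \<longleftrightarrow>
     (\<forall>P\<in>S. \<forall>Q\<in>S. \<forall>R\<in>S. P \<noteq> Q \<and> Q \<noteq> R \<and> P \<noteq> R \<longrightarrow> \<not> torus_collinear m n {P, Q, R})"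

definition tau :: "nat \<Rightarrow> nat \<Rightarrow> nat" where
  "tau m n = Max {card S | S. S \<subseteq> torus m n \<and> no_three_collinear m n S}"

definition sigma_seq :: "nat \<Rightarrow> nat \<Rightarrow> nat" where
  "sigma_seq q n = tau q n"

(* Sequences are indexed by the positive integers; the value at 0 is irrelevant. *)
definition periodic_with :: "(nat \<Rightarrow> 'a) \<Rightarrow> nat \<Rightarrow> bool" where
  "periodic_with s T \<longleftrightarrow> T > 0 \<and> (\<forall>n\<ge>1. s (n + T) = s n)"

lemma finite_tau_set: "finite {card S | S. S \<subseteq> torus m n \<and> no_three_collinear m n S}"
proof -
  have "finite {S. S \<subseteq> torus m n}" by (simp add: torus_def)
  then have "finite (card ` {S. S \<subseteq> torus m n})" by simp
  then show ?thesis by (rule rev_finite_subset) auto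
qed

lemma tau_set_nonempty: "{card S | S. S \<subseteq> torus m n \<and> no_three_collinear m n S} \<noteq> {}"
proof -
  have "no_three_collinear m n {}" by (simp add: no_three_collinear_def)
  then show ?thesis by blast
qed

lemma coprime_cross:
  fixes u v x y :: int
  assumes "coprime u v" "x * v = y * u"
  shows "\<exists>k. x = k * u \<and> y = k * v"
proof -
  obtain r s where rs: "r * u + s * v = 1"
    using bezout_int[of u v] assms(1) by (auto simp: coprime_iff_gcd_eq_1)
  define k where "k = r * x + s * y"
  have "k * u = x * (r * u) + s * (y * u)" by (simp add: k_def algebra_simps)
  also have "\<dots> = x * (r * u) + s * (x * v)" by (simp only: assms(2))
  also have "\<dots> = x * (r * u + s * v)" by (simp add: algebra_simps)
  finally have 1: "x = k * u" by (simp only: rs mult_1_right)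
  have "k * v = r * (x * v) + y * (s * v)" by (simp add: k_def algebra_simps)
  also have "\<dots> = r * (y * u) + y * (s * v)" by (simp only: assms(2))
  also have "\<dots> = y * (r * u + s * v)" by (simp add: algebra_simps)
  finally have "y = k * v" by (simp only: rs mult_1_right)
  with 1 show ?thesis by blast
qed

lemma affine_hull_lattice_points:
  assumes "coprime u v" "d \<noteq> 0"
  shows "{P. emb P \<in> affine hull {emb (a, b), emb (a + d * u, b + d * v)}}
       = {(a + k * u, b + k * v) | k. True}"
proof (intro set_eqI iffI)
  fix P
  assume "P \<in> {P. emb P \<in> affine hull {emb (a, b), emb (a + d * u, b + d * v)}}"
  then obtain s t where st: "s + t = 1"
    and P: "emb P = s *\<^sub>R emb (a, b) + t *\<^sub>R emb (a + d * u, b + d * v)"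
    unfolding affine_hull_2 by blast
  obtain x y where xy: "P = (x, y)" by (cases P)
  have s: "s = 1 - t" using st by simp
  have "real_of_int (x - a) = t * d * u" "real_of_int (y - b) = t * d * v"
    using P by (simp_all add: xy emb_def s algebra_simps)
  then have "real_of_int ((x - a) * v) = real_of_int ((y - b) * u)" by (simp del: of_int_diff)
  then have "(x - a) * v = (y - b) * u" by (simp only: of_int_eq_iff)
  from coprime_cross[OF assms(1) this] obtain k where "x - a = k * u" "y - b = k * v" by blast
  then have "x = a + k * u" "y = b + k * v" by simp_all
  then show "P \<in> {(a + k * u, b + k * v) | k. True}" using xy by blast
next
  fix P
  assume "P \<in> {(a + k * u, b + k * v) | k. True}"
  then obtain k where k: "P = (a + k * u, b + k * v)" by blast
  define t where "t = real_of_int k / real_of_int d"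
  have td: "t * d = k" using assms(2) by (simp add: t_def)
  have td': "t * (d * z) = k * z" for z :: real by (simp flip: td)
  have "emb P = (1 - t) *\<^sub>R emb (a, b) + t *\<^sub>R emb (a + d * u, b + d * v)"
    by (simp add: k emb_def ring_distribs td')
  then show "P \<in> {P. emb P \<in> affine hull {emb (a, b), emb (a + d * u, b + d * v)}}"
    unfolding affine_hull_2 mem_Collect_eq by (intro exI[of _ "1 - t"] exI[of _ t]) simp
qed

lemma lattice_line_iff:
  "lattice_line L \<longleftrightarrow> (\<exists>a b u v. coprime u v \<and> L = {(a + k * u, b + k * v) | k. True})"
proof
  assume "lattice_line L"
  then obtain l P Q where l: "affine l" "aff_dim l = 1" "P \<noteq> Q" "emb P \<in> l" "emb Q \<in> l"
    and L: "L = {P. emb P \<in> l}" unfolding lattice_line_def by blast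
  obtain a b c e where PQ: "P = (a, b)" "Q = (c, e)" by (cases P, cases Q)
  define d where "d = gcd (c - a) (e - b)"
  have d: "d \<noteq> 0" using l(3) by (auto simp: d_def PQ)
  then obtain u v where uv: "coprime u v" "c - a = u * d" "e - b = v * d"
    using gcd_coprime_exists[of "c - a" "e - b"] unfolding d_def by blast
  have Q: "Q = (a + d * u, b + d * v)" using uv(2,3) by (simp add: PQ algebra_simps)
  have "emb P \<noteq> emb Q" using l(3) by (auto simp: emb_def PQ)
  then have "aff_dim (affine hull {emb P, emb Q}) = 1" by (simp add: aff_dim_2)
  moreover have "affine hull {emb P, emb Q} \<subseteq> l" using l by (intro hull_minimal) auto
  ultimately have "affine hull {emb P, emb Q} = l"
    using l(1,2) by (intro affine_dim_equal) auto
  then have "L = {(a + k * u, b + k * v) | k. True}"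
    using affine_hull_lattice_points[OF uv(1) d, of a b] L PQ(1) Q by simp
  with uv(1) show "\<exists>a b u v. coprime u v \<and> L = {(a + k * u, b + k * v) | k. True}" by blast
next
  assume "\<exists>a b u v. coprime u v \<and> L = {(a + k * u, b + k * v) | k. True}"
  then obtain a b u v where uv: "coprime u v"
    and L: "L = {(a + k * u, b + k * v) | k. True}" by blast
  define l where "l = affine hull {emb (a, b), emb (a + 1 * u, b + 1 * v)}"
  have "u \<noteq> 0 \<or> v \<noteq> 0" using uv by auto
  then have "emb (a, b) \<noteq> emb (a + 1 * u, b + 1 * v)"
    and ne: "(a, b) \<noteq> (a + 1 * u, b + 1 * v)" by (auto simp: emb_def)
  then have "aff_dim l = 1" unfolding l_def by (simp add: aff_dim_2)
  moreover have "affine l" by (simp add: l_def)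
  moreover have "emb (a, b) \<in> l" "emb (a + 1 * u, b + 1 * v) \<in> l"
    by (simp_all add: l_def hull_inc)
  moreover have "L = {P. emb P \<in> l}"
    using affine_hull_lattice_points[OF uv, of 1 a b] by (simp only: L l_def)
  ultimately show "lattice_line L"
    unfolding lattice_line_def using ne
    by (intro exI[of _ l] conjI exI[of _ "(a, b)"] exI[of _ "(a + 1 * u, b + 1 * v)"]) simp_all
qed

end

theory Submission
  imports Defs "HOL-Number_Theory.Cong"
begin

text \<open>
  Collinearity on the torus does not require the direction \<open>(u, v)\<close> to be primitive, because the
  steps along any direction are multiples of steps along a primitive one. By the Chinese remainder
  theorem a factor of \<open>n\<close> coprime to \<open>p\<close> therefore does not affect the value at \<open>n\<close>, and only
  the \<open>p\<close>-part of \<open>n\<close> matters. The values at the powers of \<open>p\<close> increase and are at most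
  \<open>2 p\<^sup>a\<close>, by the vertical lines. This bound is attained for a large exponent by the points
  \<open>(i, e + p\<^bsup>a(i+1)\<^esup>)\<close> with \<open>0 \<le> i < p\<^sup>a\<close> and \<open>e \<in> {0, 1}\<close>, whose collinearity would contradict a
  comparison of \<open>p\<close>-adic valuations.
\<close>

section \<open>Collinearity on the torus as a pair of congruences\<close>

lemma torus_collinearE:
  assumes "torus_collinear m n S"
  obtains x0 y0 u v where
    "\<forall>x y. (x, y) \<in> S \<longrightarrow> (\<exists>k. [x = x0 + k * u] (mod int m) \<and> [y = y0 + k * v] (mod int n))"
proof -
  obtain x0 y0 u v where
    *: "S \<subseteq> torus_proj m n ` {(x0 + k * u, y0 + k * v) | k. True}"
    using assms by (auto simp: torus_collinear_def torus_line_def lattice_line_iff)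
  have "\<exists>k. [x = x0 + k * u] (mod int m) \<and> [y = y0 + k * v] (mod int n)"
    if xy: "(x, y) \<in> S" for x y
  proof -
    obtain k where "(x, y) = torus_proj m n (x0 + k * u, y0 + k * v)"
      using subsetD[OF * xy] by auto
    then show ?thesis by (auto simp: torus_proj_def cong_def)
  qed
  then show thesis using that by blast
qed

lemma torus_collinearI:
  assumes "S \<subseteq> torus m n"
    and *: "\<And>x y. (x, y) \<in> S \<Longrightarrow> \<exists>k. [x = x0 + k * u] (mod int m) \<and> [y = y0 + k * v] (mod int n)"
  shows "torus_collinear m n S"
proof -
  obtain u' v' d where uv: "coprime u' v'" "u = d * u'" "v = d * v'"
  proof (cases "gcd u v = 0")
    \<comment> \<open>The zero direction is the multiple \<open>d = 0\<close> of the primitive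
      direction \<open>(1, 0)\<close>.\<close>
    case True
    then show ?thesis using that[of 1 0 0] by simp
  next
    case False
    then show ?thesis using that gcd_coprime_exists[of u v] by (metis mult.commute)
  qed
  define L where "L = {(x0 + k * u', y0 + k * v') | k. True}"
  have "lattice_line L" using uv(1) by (auto simp: lattice_line_iff L_def)
  moreover have "S \<subseteq> torus_proj m n ` L"
  proof
    fix P assume P: "P \<in> S"
    obtain x y where xy: "P = (x, y)" by (cases P)
    obtain k where k: "[x = x0 + k * u] (mod int m)" "[y = y0 + k * v] (mod int n)"
      using * P xy by blast
    have "0 \<le> x" "x < int m" "0 \<le> y" "y < int n"
      using P assms(1) by (auto simp: xy torus_def)
    then have "P = torus_proj m n (x0 + (k * d) * u', y0 + (k * d) * v')"
      using k by (simp add: xy torus_proj_def cong_def uv(2,3) mult.assoc)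
    then show "P \<in> torus_proj m n ` L" unfolding L_def by blast
  qed
  ultimately show ?thesis
    unfolding torus_collinear_def torus_line_def by blast
qed

lemma torus_collinear_pair:
  assumes "P \<in> torus m n" "Q \<in> torus m n"
  shows "torus_collinear m n {P, Q}"
proof -
  obtain x y x' y' where PQ: "P = (x, y)" "Q = (x', y')" by (cases P, cases Q)
  have "\<exists>k. [z = x + k * (x' - x)] (mod int m) \<and> [w = y + k * (y' - y)] (mod int n)"
    if "(z, w) \<in> {P, Q}" for z w
    using that by (auto simp: PQ intro: exI[of _ 0] exI[of _ 1])
  then show ?thesis using assms by (intro torus_collinearI[of _ m n x "x' - x" y "y' - y"]) auto
qed

section \<open>Elementary bounds for \<open>tau\<close> and its monotonicity under
  divisibility\<close>

lemma card_le_tau: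
  assumes "S \<subseteq> torus m n" "no_three_collinear m n S"
  shows "card S \<le> tau m n"
  unfolding tau_def using assms finite_tau_set by (intro Max_ge) blast+

lemma tau_leI:
  assumes "\<And>S. S \<subseteq> torus m n \<Longrightarrow> no_three_collinear m n S \<Longrightarrow> card S \<le> B"
  shows "tau m n \<le> B"
  unfolding tau_def using assms finite_tau_set tau_set_nonempty by (subst Max_le_iff) blast+

lemma finite_torus [simp]: "finite (torus m n)"
  by (simp add: torus_def)

lemma card_torus [simp]: "card (torus m n) = m * n"
  by (simp add: torus_def)

lemma no_three_collinear_card_le_2:
  assumes "no_three_collinear m n S" "T \<subseteq> S" "torus_collinear m n T"
  shows "card T \<le> 2"
proof (rule ccontr)
  assume "\<not> card T \<le> 2"
  then obtain X where "X \<subseteq> T" "card X = 3"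
    by (metis obtain_subset_with_card_n not_less_eq_eq numeral_2_eq_2 numeral_3_eq_3)
  then obtain P Q R where PQR: "X = {P, Q, R}" "P \<noteq> Q" "Q \<noteq> R" "P \<noteq> R" "{P, Q, R} \<subseteq> T"
    by (auto simp: card_3_iff)
  then have "torus_collinear m n {P, Q, R}"
    using assms(3) unfolding torus_collinear_def by blast
  then show False using assms(1,2) PQR unfolding no_three_collinear_def by auto
qed

text \<open>Each fibre of \<open>f\<close> in \<open>S\<close> lies on one line and so has at most
  two points; summing over \<open>C\<close> gives the bound.\<close>

lemma no_three_collinear_card_le_image:
  assumes "no_three_collinear m n S" "S \<subseteq> torus m n" "f ` S \<subseteq> C" "finite C"
    and "\<And>c. torus_collinear m n {P \<in> S. f P = c}"
  shows "card S \<le> 2 * card C"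
proof -
  have "S = (\<Union>c\<in>C. {P \<in> S. f P = c})" using assms(3) by auto
  then have "card S \<le> (\<Sum>c\<in>C. card {P \<in> S. f P = c})"
    using card_UN_le[OF assms(4)] by metis
  also have "\<dots> \<le> (\<Sum>c\<in>C. 2)"
    using assms(1,5) by (intro sum_mono no_three_collinear_card_le_2) auto
  finally show ?thesis by simp
qed

text \<open>Every column lies on a line of direction \<open>(0, 1)\<close>, and there are
  \<open>m\<close> columns.\<close>

lemma tau_le_width: "tau m n \<le> 2 * m"
proof (rule tau_leI)
  fix S assume S: "S \<subseteq> torus m n" "no_three_collinear m n S"
  have "torus_collinear m n {P \<in> S. fst P = c}" for c
  proof -
    have "[x = c + y * 0] (mod int m) \<and> [y = 0 + y * 1] (mod int n)"
      if "(x, y) \<in> {P \<in> S. fst P = c}" for x y using that by simp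
    then show ?thesis using S(1) by (intro torus_collinearI[of _ m n c 0 0 1]) blast+
  qed
  with S have "card S \<le> 2 * card {0..<int m}"
    by (intro no_three_collinear_card_le_image[of m n S fst]) (auto simp: torus_def)
  then show "card S \<le> 2 * m" by simp
qed

lemma tau_le_height: "tau m n \<le> 2 * n"
proof (rule tau_leI)
  fix S assume S: "S \<subseteq> torus m n" "no_three_collinear m n S"
  have "torus_collinear m n {P \<in> S. snd P = c}" for c
  proof -
    have "[x = 0 + x * 1] (mod int m) \<and> [y = c + x * 0] (mod int n)"
      if "(x, y) \<in> {P \<in> S. snd P = c}" for x y using that by simp
    then show ?thesis using S(1) by (intro torus_collinearI[of _ m n 0 1 c 0]) blast+
  qed
  with S have "card S \<le> 2 * card {0..<int n}"
    by (intro no_three_collinear_card_le_image[of m n S snd]) (auto simp: torus_def)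
  then show "card S \<le> 2 * n" by simp
qed

lemma tau_ge_2:
  assumes "m * n \<ge> 2"
  shows "tau m n \<ge> 2"
proof -
  obtain S where S: "S \<subseteq> torus m n" "card S = 2"
    using obtain_subset_with_card_n[of 2 "torus m n"] assms by auto
  have "no_three_collinear m n S"
    using S(2) by (auto simp: no_three_collinear_def card_2_iff)
  with S show ?thesis using card_le_tau by metis
qed

text \<open>The same set \<open>S\<close> works on the larger torus: reduction modulo
  \<open>n\<close> fixes its points and sends lines to lines, so a triple collinear modulo
  \<open>n'\<close> is already collinear modulo \<open>n\<close>.\<close>

lemma tau_mono_dvd:
  assumes "n dvd n'" "n' > 0"
  shows "tau m n \<le> tau m n'"
proof (rule tau_leI)
  fix S assume S: "S \<subseteq> torus m n" "no_three_collinear m n S"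
  have "n \<le> n'" using assms by (rule dvd_imp_le)
  then have S': "S \<subseteq> torus m n'" using S(1) by (auto simp: torus_def)
  have "torus_collinear m n T" if T: "torus_collinear m n' T" "T \<subseteq> S" for T
  proof -
    obtain x0 y0 u v where *: "\<forall>x y. (x, y) \<in> T \<longrightarrow> (\<exists>k.
        [x = x0 + k * u] (mod int m) \<and> [y = y0 + k * v] (mod int n'))"
      using T(1) by (rule torus_collinearE) (rule that)
    have cong: "[y = z] (mod int n)" if "[y = z] (mod int n')" for y z
      using cong_dvd_modulus[OF that] assms(1) by simp
    have "\<exists>k. [x = x0 + k * u] (mod int m) \<and> [y = y0 + k * v] (mod int n)"
      if "(x, y) \<in> T" for x y using * that cong by blast
    then show ?thesis using T(2) S(1) by (intro torus_collinearI[of T m n x0 u y0 v]) auto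
  qed
  then have "no_three_collinear m n' S"
    using S(2) unfolding no_three_collinear_def by (metis empty_subsetI insert_subset)
  with S' show "card S \<le> tau m n'" by (rule card_le_tau)
qed

section \<open>Removing a coprime factor of the height\<close>

text \<open>A line modulo \<open>n\<close> lifts to one that imposes no condition modulo
  \<open>k\<close>: the line parameter can be prescribed modulo \<open>k\<close> independently of
  its residue modulo \<open>m * n\<close>.\<close>

lemma torus_collinear_coprime_factor:
  assumes "coprime k (m * n)" "S \<subseteq> torus m (n * k)"
    and "torus_collinear m n (map_prod id (\<lambda>y. y mod int n) ` S)"
  shows "torus_collinear m (n * k) S"
proof -
  have cop: "coprime (int k) (int (m * n))" "coprime (int n) (int k)"
    using assms(1) by (simp_all add: coprime_commute)
  obtain x0 y0 u v0 where *: "\<forall>x y. (x, y) \<in> map_prod id (\<lambda>y. y mod int n) ` S \<longrightarrow> (\<exists>j.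
      [x = x0 + j * u] (mod int m) \<and> [y = y0 + j * v0] (mod int n))"
    using assms(3) by (rule torus_collinearE) (rule that)
  \<comment> \<open>Slope 1 modulo \<open>k\<close> lets the lifted line reach every second
    coordinate modulo \<open>k\<close>.\<close>
  obtain v where v: "[v = v0] (mod int n)" "[v = 1] (mod int k)"
    using binary_chinese_remainder_int[OF cop(2)] by blast
  have "\<exists>j. [x = x0 + j * u] (mod int m) \<and> [y = y0 + j * v] (mod int (n * k))"
    if "(x, y) \<in> S" for x y
  proof -
    have "(x, y mod int n) \<in> map_prod id (\<lambda>y. y mod int n) ` S"
      using that by (force simp: image_iff)
    from *[rule_format, OF this] obtain j where j: "[x = x0 + j * u] (mod int m)"
      "[y mod int n = y0 + j * v0] (mod int n)" by blast
    then have j2: "[y = y0 + j * v0] (mod int n)" by (simp add: cong_def)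
    \<comment> \<open>The residue modulo \<open>k\<close> solves \<open>y = y0 + i * v\<close>
      there; agreement with \<open>j\<close> modulo \<open>m * n\<close> keeps the two known
      congruences.\<close>
    obtain i where i: "[i = y - y0] (mod int k)" "[i = j] (mod int (m * n))"
      using binary_chinese_remainder_int[OF cop(1)] by blast
    have i': "[i = j] (mod int m)" "[i = j] (mod int n)"
      using i(2) by (auto intro: cong_dvd_modulus)
    have "[x0 + i * u = x0 + j * u] (mod int m)"
      by (intro cong_add cong_mult cong_refl i')
    with j(1) have "[x = x0 + i * u] (mod int m)" by (metis cong_sym cong_trans)
    moreover have "[y0 + i * v = y0 + j * v0] (mod int n)"
      by (intro cong_add cong_mult cong_refl i' v)
    with j2 have "[y = y0 + i * v] (mod int n)" by (metis cong_sym cong_trans)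
    moreover have "[y0 + i * v = y0 + (y - y0) * 1] (mod int k)"
      by (intro cong_add cong_mult cong_refl i v)
    then have "[y = y0 + i * v] (mod int k)" by (simp add: cong_sym_eq)
    ultimately show ?thesis
      using coprime_cong_mult[OF _ _ cop(2)] by auto
  qed
  then show ?thesis using assms(2) by (intro torus_collinearI[of S m _ x0 u y0 v]) blast+
qed

lemma tau_coprime_factor:
  assumes "coprime k (m * n)" "m * n \<ge> 2" "k > 0"
  shows "tau m (n * k) = tau m n"
proof (rule antisym)
  show "tau m n \<le> tau m (n * k)"
    using assms by (intro tau_mono_dvd) (auto intro: Nat.gr0I)
  let ?h = "map_prod id (\<lambda>y. y mod int n) :: int \<times> int \<Rightarrow> int \<times> int"
  show "tau m (n * k) \<le> tau m n"
  proof (rule tau_leI)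
    fix S assume S: "S \<subseteq> torus m (n * k)" "no_three_collinear m (n * k) S"
    have "n > 0" using assms(2) by (auto intro: Nat.gr0I)
    then have hS: "?h ` S \<subseteq> torus m n" using S(1) by (auto simp: torus_def)
    have noncoll: "\<not> torus_collinear m n (?h ` {P, Q, R})"
      if "{P, Q, R} \<subseteq> S" "P \<noteq> Q" "Q \<noteq> R" "P \<noteq> R" for P Q R
    proof
      assume coll: "torus_collinear m n (?h ` {P, Q, R})"
      have "torus_collinear m (n * k) {P, Q, R}"
        by (rule torus_collinear_coprime_factor[OF assms(1) _ coll]) (use that S(1) hS in auto)
      then show False using S(2) that unfolding no_three_collinear_def by auto
    qed
    show "card S \<le> tau m n"
    proof (cases "card S \<le> 2")
      case True
      then show ?thesis using tau_ge_2[OF assms(2)] by linarith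
    next
      case False
      \<comment> \<open>If two points had the same image, adding a third would give a triple whose
        image has at most two points and is therefore collinear. This needs a third point, hence the
        separate case of small \<open>S\<close>.\<close>
      have "inj_on ?h S"
      proof (rule inj_onI, rule ccontr)
        fix P Q assume PQ: "P \<in> S" "Q \<in> S" "?h P = ?h Q" "P \<noteq> Q"
        have "\<not> S \<subseteq> {P, Q}" using False card_mono[of "{P, Q}" S] PQ(4) by auto
        then obtain R where R: "R \<in> S" "R \<noteq> P" "R \<noteq> Q" by blast
        have "?h ` {P, Q, R} = {?h P, ?h R}" using PQ(3) by auto
        moreover have "torus_collinear m n {?h P, ?h R}"
          using hS PQ R by (intro torus_collinear_pair) auto
        ultimately show False using noncoll[of P Q R] PQ R by auto
      qed
      then have "card S = card (?h ` S)" by (simp add: card_image)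
      also have "no_three_collinear m n (?h ` S)"
        unfolding no_three_collinear_def
      proof (intro ballI impI, elim conjE)
        fix P Q R assume "P \<in> ?h ` S" "Q \<in> ?h ` S" "R \<in> ?h ` S"
          and ne: "P \<noteq> Q" "Q \<noteq> R" "P \<noteq> R"
        then obtain P' Q' R' where eq: "P' \<in> S" "Q' \<in> S" "R' \<in> S"
          "P = ?h P'" "Q = ?h Q'" "R = ?h R'"
          by (elim imageE) (rule that; assumption)
        have "\<not> torus_collinear m n (?h ` {P', Q', R'})"
          by (rule noncoll) (use eq ne in auto)
        then show "\<not> torus_collinear m n {P, Q, R}" by (simp add: eq)
      qed
      then have "card (?h ` S) \<le> tau m n" using hS by (intro card_le_tau)
      finally show ?thesis .
    qed
  qed
qed

section \<open>Valuations and a configuration of maximal size\<close>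

text \<open>For \<open>x\<close> nonzero valuations add, and \<open>y\<close> accounts for at most
  \<open>c\<close> of the \<open>c + a\<close> factors \<open>p\<close>.\<close>

lemma prime_power_dvd_mult_cancel:
  fixes p x y :: int
  assumes "prime p" "p ^ (c + a) dvd x * y" "\<not> p ^ Suc c dvd y"
  shows "p ^ a dvd x"
proof (cases "x = 0")
  case False
  have y: "y \<noteq> 0" using assms(3) by auto
  have p: "\<not> is_unit p" "prime_elem p" using assms(1) by (auto simp: not_prime_unit)
  have "c + a \<le> multiplicity p (x * y)"
    using assms(2) False y p(1) by (subst power_dvd_iff_le_multiplicity[symmetric]) auto
  also have "\<dots> = multiplicity p x + multiplicity p y"
    using False y p(2) by (intro prime_elem_multiplicity_mult_distrib)
  finally have "a \<le> multiplicity p x"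
    using assms(3) y p(1) by (subst (asm) power_dvd_iff_le_multiplicity) auto
  then show ?thesis by (rule multiplicity_dvd')
qed simp

text \<open>
  If the points were collinear, \<open>A - C\<close> and \<open>B - C\<close> (with the \<open>x\<close>-coordinates suitably lifted) would
  be proportional modulo \<open>p\<^sup>b\<close>, but the valuations of the two cross products differ.
\<close>

lemma not_torus_collinear_valuation:
  fixes p :: nat
  assumes "prime p"
    and "\<not> [xB = xA] (mod int p ^ a)"
    and "\<not> int p ^ Suc c dvd yC - yA" "int p ^ (c + a) dvd yB - yA" "c + a \<le> b"
  shows "\<not> torus_collinear (p ^ a) (p ^ b) {(xA, yA), (xB, yB), (xC, yC)}"
proof
  assume coll: "torus_collinear (p ^ a) (p ^ b) {(xA, yA), (xB, yB), (xC, yC)}"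
  obtain x0 y0 u v where *: "\<forall>x y. (x, y) \<in> {(xA, yA), (xB, yB), (xC, yC)} \<longrightarrow> (\<exists>k.
      [x = x0 + k * u] (mod int p ^ a) \<and> [y = y0 + k * v] (mod int p ^ b))"
    by (rule torus_collinearE[OF coll, unfolded of_nat_power]) (rule that)
  obtain i where i: "[xA = x0 + i * u] (mod int p ^ a)" "[yA = y0 + i * v] (mod int p ^ b)"
    using *[rule_format, of xA yA] by auto
  obtain j where j: "[xB = x0 + j * u] (mod int p ^ a)" "[yB = y0 + j * v] (mod int p ^ b)"
    using *[rule_format, of xB yB] by auto
  obtain k where k: "[yC = y0 + k * v] (mod int p ^ b)"
    using *[rule_format, of xC yC] by auto
  have pb: "int p ^ (c + a) dvd int p ^ b" using assms(5) by (rule le_imp_power_dvd)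
  have mod_ca: "[y = z] (mod int p ^ (c + a))" if "[y = z] (mod int p ^ b)" for y z
    using that pb by (rule cong_dvd_modulus)
  have B: "[yB - yA = (y0 + j * v) - (y0 + i * v)] (mod int p ^ (c + a))"
    by (intro cong_diff mod_ca i(2) j(2))
  have C: "[yC - yA = (y0 + k * v) - (y0 + i * v)] (mod int p ^ (c + a))"
    by (intro cong_diff mod_ca i(2) k)
  have "[(j - i) * u * (yC - yA) = (j - i) * u * ((y0 + k * v) - (y0 + i * v))] (mod int p ^ (c + a))"
    by (intro cong_mult cong_refl C)
  \<comment> \<open>Both sides equal \<open>(j - i) * (k - i) * u * v\<close>. The right one is then
    divisible by \<open>p ^ (c + a)\<close> because \<open>yB - yA\<close> is.\<close>
  also have "(j - i) * u * ((y0 + k * v) - (y0 + i * v))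
      = (k - i) * u * ((y0 + j * v) - (y0 + i * v))" by (simp add: algebra_simps)
  also have "[\<dots> = (k - i) * u * (yB - yA)] (mod int p ^ (c + a))"
    by (intro cong_mult cong_refl cong_sym[OF B])
  finally have "int p ^ (c + a) dvd (j - i) * u * (yC - yA)"
    using assms(4) by (simp add: cong_dvd_iff)
  moreover have "prime (int p)" using assms(1) by simp
  moreover have "\<not> int p ^ Suc c dvd yC - yA" by fact
  ultimately have "int p ^ a dvd (j - i) * u"
    by (blast intro: prime_power_dvd_mult_cancel)
  then have "[x0 + j * u = x0 + i * u] (mod int p ^ a)"
    by (simp add: cong_iff_dvd_diff algebra_simps)
  then have "[xB = xA] (mod int p ^ a)" using i(1) j(1) by (metis cong_sym cong_trans)
  then show False using assms(2) by blast
qed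

text \<open>Two points are placed in each of the \<open>p ^ a\<close> columns. Exponents spaced by
  \<open>a\<close> create the valuation gap for triples with equal offsets \<open>e\<close>; for
  mixed offsets a difference of 1 or -1 does.\<close>

lemma tau_prime_power_attained:
  fixes p a :: nat
  assumes "prime p" "a > 0"
  shows "tau (p ^ a) (p ^ (a * (p ^ a + 1))) = 2 * p ^ a"
proof (rule antisym)
  define q where "q = p ^ a"
  \<comment> \<open>All exponents \<open>a * (i + 1)\<close> are at most \<open>a * q\<close>,
    strictly below \<open>b\<close>, which leaves room for the offset \<open>e\<close>.\<close>
  define b where "b = a * (q + 1)"
  define f where "f = (\<lambda>(i, e). (int i, e + int p ^ (a * (i + 1))))"
  define S where "S = f ` ({..<q} \<times> {0, 1})"
  have p: "p > 1" "int p > 1" using assms(1) prime_gt_1_nat[of p] by auto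
  have f_torus: "f P \<in> torus (p ^ a) (p ^ b)" if "P \<in> {..<q} \<times> {0, 1}" for P
  proof -
    obtain i e where Pie: "P = (i, e)" by (cases P)
    then have P: "P = (i, e)" "i < q" "e = 0 \<or> e = 1" using that by auto
    then have lt: "a * (i + 1) < b" using assms(2) by (simp add: b_def)
    have "int p ^ (a * (i + 1)) * 2 \<le> int p ^ (a * (i + 1)) * int p"
      using p(2) by (intro mult_left_mono) auto
    also have "\<dots> = int p ^ Suc (a * (i + 1))" by simp
    also have "\<dots> \<le> int p ^ b"
      using lt p(2) by (intro power_increasing) auto
    finally have "int p ^ (a * (i + 1)) * 2 \<le> int p ^ b" .
    moreover have "int p ^ (a * (i + 1)) > 1"
      using p(2) assms(2) by (intro one_less_power) auto
    ultimately show ?thesis using P by (auto simp: torus_def f_def q_def)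
  qed
  have not_cong: "\<not> [int j = int i] (mod int p ^ a)" if "i < q" "j < q" "i \<noteq> j" for i j
  proof -
    have "int i < int p ^ a" "int j < int p ^ a"
      using that by (metis q_def of_nat_less_iff of_nat_power)+
    then show ?thesis using that(3) by (simp add: cong_def)
  qed
  \<comment> \<open>The base point has the largest exponent, so its difference to
    \<open>f (i, e)\<close> has valuation exactly \<open>a * (i + 1)\<close>, while its difference
    to \<open>f (j, e)\<close> is divisible by at least \<open>a\<close> further factors
    \<open>p\<close>.\<close>
  have same: "\<not> torus_collinear (p ^ a) (p ^ b) {f (k, e), f (j, e), f (i, e)}"
    if "i < j" "j < k" "k < q" "e \<in> {0, 1}" for i j k e
  proof -
    have exps: "a * (i + 1) + a \<le> a * (j + 1)" "a * (j + 1) \<le> a * (k + 1)"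
      "Suc (a * (i + 1)) \<le> a * (k + 1)" "a * (i + 1) + a \<le> b"
    proof -
      have "a * (i + 1) + a = a * (i + 2)" by simp
      also have "\<dots> \<le> a * (j + 1)" using that by (intro mult_le_mono2) simp
      finally show 1: "a * (i + 1) + a \<le> a * (j + 1)" .
      show 2: "a * (j + 1) \<le> a * (k + 1)" using that by (intro mult_le_mono2) simp
      show "Suc (a * (i + 1)) \<le> a * (k + 1)" using 1 2 assms(2) by linarith
      have "a * (k + 1) \<le> b" unfolding b_def using that by (intro mult_le_mono2) simp
      then show "a * (i + 1) + a \<le> b" using 1 2 by linarith
    qed
    have "\<not> int p ^ Suc (a * (i + 1)) dvd int p ^ (a * (i + 1))"
      using p(2) by (subst dvd_power_iff) auto
    moreover have "int p ^ Suc (a * (i + 1)) dvd int p ^ (a * (k + 1))"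
      using exps(3) by (rule le_imp_power_dvd)
    ultimately have "\<not> int p ^ Suc (a * (i + 1)) dvd int p ^ (a * (i + 1)) - int p ^ (a * (k + 1))"
      by (metis dvd_diff_right_iff dvd_diff_commute)
    moreover have "int p ^ (a * (i + 1) + a) dvd int p ^ (a * (j + 1)) - int p ^ (a * (k + 1))"
      using exps(1,2) by (intro dvd_diff le_imp_power_dvd) (blast intro: order.trans)+
    ultimately show ?thesis
      unfolding f_def prod.case using that not_cong[of k j] exps(4)
      by (intro not_torus_collinear_valuation[OF assms(1), where c = "a * (i + 1)"]) auto
  qed
  \<comment> \<open>The column \<open>k\<close> may coincide with \<open>i\<close> or
    \<open>j\<close>; only the two points with equal offset need distinct columns.\<close>
  have mixed: "\<not> torus_collinear (p ^ a) (p ^ b) {f (i, e), f (j, e), f (k, e')}"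
    if "i \<noteq> j" "i < q" "j < q" "k < q" "e \<noteq> e'" "e \<in> {0, 1}" "e' \<in> {0, 1}" for i j k e e'
  proof -
    have dvd: "int p dvd int p ^ (a * (l + 1))" for l using assms(2) by (intro dvd_power) auto
    have "\<not> int p dvd e' - e"
      using that p(2) by (auto simp: zdvd_not_zless)
    moreover have "int p dvd int p ^ (a * (k + 1)) - int p ^ (a * (i + 1))"
      by (intro dvd_diff dvd)
    ultimately have "\<not> int p dvd (e' - e) + (int p ^ (a * (k + 1)) - int p ^ (a * (i + 1)))"
      by (metis dvd_add_left_iff)
    then have "\<not> int p ^ Suc 0 dvd (e' + int p ^ (a * (k + 1))) - (e + int p ^ (a * (i + 1)))"
      by (simp add: algebra_simps)
    moreover have "int p ^ (0 + a) dvd (e + int p ^ (a * (j + 1))) - (e + int p ^ (a * (i + 1)))"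
      by (auto intro!: dvd_diff le_imp_power_dvd)
    moreover have "0 + a \<le> b" by (simp add: b_def)
    ultimately show ?thesis
      unfolding f_def prod.case using that not_cong[of i j]
      by (intro not_torus_collinear_valuation[OF assms(1), where c = 0]) auto
  qed
  have "no_three_collinear (p ^ a) (p ^ b) S"
    unfolding no_three_collinear_def
  proof (intro ballI impI, elim conjE)
    fix P Q R assume "P \<in> S" "Q \<in> S" "R \<in> S" and ne: "P \<noteq> Q" "Q \<noteq> R" "P \<noteq> R"
    then obtain i e j e' k e'' where eq: "P = f (i, e)" "Q = f (j, e')" "R = f (k, e'')"
      and lt: "i < q" "j < q" "k < q" and e: "e \<in> {0, 1}" "e' \<in> {0, 1}" "e'' \<in> {0, 1}"
      unfolding S_def by blast
    consider "e = e'" "e' = e''" | "e = e'" "e \<noteq> e''" | "e' = e''" "e' \<noteq> e" | "e = e''" "e \<noteq> e'"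
      using e by auto
    then show "\<not> torus_collinear (p ^ a) (p ^ b) {P, Q, R}"
    proof cases
      case 1
      then have "i \<noteq> j" "j \<noteq> k" "i \<noteq> k" using ne eq by auto
      then consider "i < j" "j < k" | "i < k" "k < j" | "j < i" "i < k" | "j < k" "k < i"
        | "k < i" "i < j" | "k < j" "j < i" by linarith
      then show ?thesis
        by cases (use same[of i j k e] same[of i k j e] same[of j i k e] same[of j k i e]
            same[of k i j e] same[of k j i e] 1 eq lt e in \<open>simp_all add: insert_commute\<close>)
    next
      case 2
      then have "i \<noteq> j" using ne eq by auto
      then show ?thesis using mixed[of i j k e e''] 2 eq lt e by simp
    next
      case 3
      then have "j \<noteq> k" using ne eq by auto
      then show ?thesis using mixed[of j k i e' e] 3 eq lt e by (simp add: insert_commute)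
    next
      case 4
      then have "i \<noteq> k" using ne eq by auto
      then show ?thesis using mixed[of i k j e e'] 4 eq lt e by (simp add: insert_commute)
    qed
  qed
  moreover have "S \<subseteq> torus (p ^ a) (p ^ b)" unfolding S_def using f_torus by blast
  ultimately have "card S \<le> tau (p ^ a) (p ^ b)" by (intro card_le_tau)
  moreover have "inj_on f ({..<q} \<times> {0, 1})" by (auto simp: inj_on_def f_def)
  then have "card S = 2 * q" by (simp add: S_def card_image)
  ultimately show "2 * p ^ a \<le> tau (p ^ a) (p ^ (a * (p ^ a + 1)))"
    by (simp only: b_def q_def)
qed (rule tau_le_width)

section \<open>Shape of the minimum and periodicity\<close>

theorem theorem4:
  fixes p a :: nat
  assumes "prime p" and "a > 0"
  shows "(\<exists>x\<ge>1. sigma_seq (p ^ a) x = 2 * p ^ a) \<and>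
         (let m = (LEAST x. x \<ge> 1 \<and> sigma_seq (p ^ a) x = 2 * p ^ a)
          in (\<exists>b\<ge>a. m = p ^ b) \<and> periodic_with (sigma_seq (p ^ a)) m)"
proof -
  let ?s = "sigma_seq (p ^ a)"
  have p: "p > 1" using assms(1) by (rule prime_gt_1_nat)
  have coprime_factor: "?s (p ^ c * k) = ?s (p ^ c)" if "\<not> p dvd k" for c k
  proof -
    have "k > 0" using that by (auto intro: Nat.gr0I)
    moreover have "coprime k (p ^ a * p ^ c)"
      using prime_imp_coprime[OF assms(1) that] by (simp add: coprime_commute)
    moreover have "2 * 1 \<le> p ^ a * p ^ c"
      using p one_less_power[OF p assms(2)] by (intro mult_le_mono) auto
    ultimately show ?thesis unfolding sigma_seq_def by (intro tau_coprime_factor) auto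
  qed
  \<comment> \<open>A value that has reached the upper bound stays there at all positive
    multiples.\<close>
  have mono: "?s n = 2 * p ^ a" if "?s k = 2 * p ^ a" "k dvd n" "n > 0" for k n
    using tau_mono_dvd[OF that(2,3), of "p ^ a"] tau_le_width[of "p ^ a" n] that(1)
    by (simp add: sigma_seq_def)
  have ex: "\<exists>x. x \<ge> 1 \<and> ?s x = 2 * p ^ a"
    using tau_prime_power_attained[OF assms] p unfolding sigma_seq_def
    by (intro exI[of _ "p ^ (a * (p ^ a + 1))"]) (simp add: Suc_leI)
  define m where "m = (LEAST x. x \<ge> 1 \<and> ?s x = 2 * p ^ a)"
  have m: "m \<ge> 1" "?s m = 2 * p ^ a" using LeastI_ex[OF ex] by (auto simp: m_def)
  have p_part: "\<exists>c k. n = p ^ c * k \<and> \<not> p dvd k" if "n > 0" for n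
    using multiplicity_decompose'[of n p] that p by (metis less_numeral_extra(4) nat_dvd_1_iff_1 neq0_conv)
  obtain b k where bk: "m = p ^ b * k" "\<not> p dvd k" using p_part[of m] m(1) by auto
  \<comment> \<open>Dropping the cofactor \<open>k\<close> keeps the value, so minimality of
    \<open>m\<close> forces \<open>k = 1\<close>.\<close>
  have "m \<le> p ^ b"
    unfolding m_def using m(2) coprime_factor[OF bk(2)] bk(1) p by (intro Least_le) (simp add: Suc_leI)
  then have mb: "m = p ^ b" using bk(1) m(1) p by (cases k) auto
  \<comment> \<open>Counting along rows bounds the value at \<open>m\<close> by
    \<open>2 * m\<close>.\<close>
  have "2 * p ^ a \<le> 2 * p ^ b"
    using tau_le_height[of "p ^ a" m] m(2) by (simp add: sigma_seq_def mb)
  then have "a \<le> b" using p by simp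
  moreover have "?s (n + m) = ?s n" if n: "n \<ge> 1" for n
  proof (cases "m dvd n")
    case True
    then show ?thesis using mono[OF m(2), of n] mono[OF m(2), of "n + m"] n by simp
  next
    case False
    obtain c j where cj: "n = p ^ c * j" "\<not> p dvd j" using p_part[of n] n by auto
    \<comment> \<open>Since \<open>m = p ^ b\<close> does not divide \<open>n\<close>, adding
      \<open>m\<close> leaves the exact power \<open>p ^ c\<close> in \<open>n\<close> unchanged,
      and only that power determines the value.\<close>
    have "c < b" using False cj(1) mb by (metis dvd_mult2 le_imp_power_dvd not_le)
    then have "n + m = p ^ c * (j + p ^ (b - c))"
      by (simp add: cj(1) mb algebra_simps flip: power_add)
    moreover have "\<not> p dvd j + p ^ (b - c)"
      using cj(2) \<open>c < b\<close> by (simp add: dvd_add_left_iff)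
    ultimately show ?thesis using coprime_factor cj by metis
  qed
  ultimately have "(\<exists>b\<ge>a. m = p ^ b) \<and> periodic_with ?s m"
    using m(1) mb p by (auto simp: periodic_with_def)
  with ex show ?thesis by (simp add: m_def Let_def)
qed

end
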